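(* Let $d\ge1$. Assume $\kappa_d$ is algebraic with $D=[\mathbb{Q}(\kappa_d):\mathbb{Q}]$, and suppose $p^k\in E_d$ for a prime $p$ and an integer $k\ge1$. Then: (1) $D$ is a positive power of $p$. (2) If $p\in\mathrm{Tame}_d$ is odd, then $D=p^r$ where $r\le kd\le r+\nu_p(a_d(p)-1)-1$. In particular, $$|\{j\ge1: p^j\in E_d\}|\le\left\lfloor\frac{\nu_p(a_d(p)-1)-1}{d}\right\rfloor+1.$$ (3) If $p=2$ or $p=3$, then $D=p^{kd}$. In particular, at most one power of $p$ can belong to $E_d$.
   Context: For integers $d,n\ge1$, $T_d(n)$ is the Cayley graph of $(\mathbb{Z}/n\mathbb{Z})^d$ with respect to $\{\pm e_1,\dots,\pm e_d\}\setminus\{0\}$ ($e_i$ the standard basis vectors); it is a simple graph, and $T_d(1)$ is a single vertex with no edges. $a_d(n)$ is the number of independent sets of $T_d(n)$ (including the empty set), so $a_d(1)=2$. The limit $\kappa_d=\lim_{n\to\infty}a_d(n)^{1/n^d}$ exists and is a positive real number. $E_d=\{n\ge1: a_d(n)=\kappa_d^{n^d}\}$. $\nu_p$ is the $p$-adic valuation with $\nu_p(p)=1$. A prime $p$ is tame with respect to $d$ if $\nu_p(a_d(p^k)-1)=\nu_p(a_d(p)-1)$ for every $k\ge1$; $\mathrm{Tame}_d$ is the set of such primes. *)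

theory Defs
  imports
    Complex_Main
    "HOL-Algebra.Product_Groups"
    "HOL-Algebra.Elementary_Groups"
    "HOL-Algebra.Generated_Fields"
    "HOL-Algebra.Algebraic_Closure_Type"
begin

text \<open>
  A simple graph is a pair (V, E) of a vertex set and a set of two-element subsets of V.
  For a symmetric set S without the identity, the edges below are the pairs
  {x, xs} of distinct elements.
\<close>

type_synonym 'a graph = "'a set \<times> 'a set set"

definition cayley_graph :: "('a, 'b) monoid_scheme \<Rightarrow> 'a set \<Rightarrow> 'a graph" where
  "cayley_graph G S = (carrier G, {{x, x \<otimes>\<^bsub>G\<^esub> s} | x s. x \<in> carrier G \<and> s \<in> S})"

definition independent_sets :: "'a graph \<Rightarrow> 'a set set" where
  "independent_sets \<Gamma> = {I. I \<subseteq> fst \<Gamma> \<and> (\<forall>e \<in> snd \<Gamma>. \<not> e \<subseteq> I)}"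

definition torus_group :: "nat \<Rightarrow> nat \<Rightarrow> (nat \<Rightarrow> int) monoid" where
  "torus_group d n = product_group {..<d} (\<lambda>_. integer_mod_group n)"

text \<open>The reduction modulo n makes the basis vectors trivial for n = 1.\<close>

definition basis_vec :: "nat \<Rightarrow> nat \<Rightarrow> nat \<Rightarrow> (nat \<Rightarrow> int)" where
  "basis_vec d n i = (\<lambda>j\<in>{..<d}. if j = i then 1 mod int n else 0)"

definition torus_gens :: "nat \<Rightarrow> nat \<Rightarrow> (nat \<Rightarrow> int) set" where
  "torus_gens d n =
     (\<Union>i<d. {basis_vec d n i, inv\<^bsub>torus_group d n\<^esub> (basis_vec d n i)}) - {\<one>\<^bsub>torus_group d n\<^esub>}"

definition torus_graph :: "nat \<Rightarrow> nat \<Rightarrow> (nat \<Rightarrow> int) graph" where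
  "torus_graph d n = cayley_graph (torus_group d n) (torus_gens d n)"

text \<open>
  Only the values at n \<ge> 1 are meaningful: the library takes the integers modulo 0
  to be the infinite group of all integers.
\<close>

definition indep_count :: "nat \<Rightarrow> nat \<Rightarrow> nat" where
  "indep_count d n = card (independent_sets (torus_graph d n))"

definition kappa :: "nat \<Rightarrow> real" where
  "kappa d = lim (\<lambda>n. real (indep_count d n) powr (1 / real (n ^ d)))"

definition E_set :: "nat \<Rightarrow> nat set" where
  "E_set d = {n. n \<ge> 1 \<and> real (indep_count d n) = kappa d ^ (n ^ d)}"

text \<open>
  The count is at least 2 for n \<ge> 1, so the subtraction of natural numbers is exact
  and its result is nonzero.
\<close>

definition Tame :: "nat \<Rightarrow> nat set" where
  "Tame d = {p. prime p \<and>
     (\<forall>k\<ge>1. multiplicity p (indep_count d (p ^ k) - 1) = multiplicity p (indep_count d p - 1))}"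

text \<open>
  The dimension over the rationals of the field that x generates inside the real numbers;
  a generated subfield contains 1, hence all rationals. The library dimension is a definite
  description, meaningful only if the extension is finite, that is, if x is algebraic.
\<close>

definition rat_degree :: "real \<Rightarrow> nat" where
  "rat_degree x = ring.dim ring_of_type_algebra \<rat> (generate_field ring_of_type_algebra {x})"

end

theory Submission
  imports
    Defs
    "HOL-Algebra.Group_Action"
    "HOL-Number_Theory.Residues"
begin

text \<open>
  If \<open>p ^ k \<in> E_set d\<close>, then \<open>\<kappa> = kappa d\<close> is a root of order \<open>p ^ (k * d)\<close> of the count
  \<open>A = indep_count d (p ^ k)\<close>. Write \<open>A = m ^ (p ^ s)\<close> with \<open>s\<close> maximal and \<open>r = k * d - s\<close>; then
  \<open>\<kappa> ^ (p ^ r) = m\<close> with \<open>m\<close> not a \<open>p\<close>-th power, so \<open>X ^ (p ^ r) - m\<close> is irreducible and \<open>\<kappa>\<close> has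
  degree \<open>p ^ r\<close>. The translations of the torus form a \<open>p\<close>-group acting on the independent sets, and
  the empty set is its only fixed point; hence \<open>A\<close>, and with it \<open>m\<close>, is 1 modulo \<open>p\<close>. This gives
  \<open>m \<ge> 3\<close>, whereas \<open>A \<le> 2 ^ (p ^ (k * d))\<close>, so \<open>s < k * d\<close>; it also gives
  \<open>p ^ (s + 1) dvd A - 1\<close>, which in the tame case bounds \<open>s\<close>.

  For \<open>p \<le> 3\<close> the nonempty independent sets with orbits of length \<open>p\<close> are exactly the fibres of
  the homomorphisms from the torus to the integers modulo \<open>p\<close> that vanish on no basis vector. Normalised
  to be 1 on the first basis vector, there are \<open>(p - 1) ^ (d - 1)\<close> of these, so \<open>A\<close> is
  \<open>1 + p * (p - 1) ^ (d - 1)\<close> modulo \<open>p ^ 2\<close>, hence not a \<open>p\<close>-th power, and \<open>s = 0\<close>.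
\<close>

section \<open>Degrees of radicals over the rationals\<close>

text \<open>Over the complex numbers \<open>G\<close> splits, and up to sign its constant term is
  the leading coefficient times the product of the roots.\<close>

lemma norm_poly_0_eq_of_norm_roots_eq:
  fixes G :: "complex poly"
  assumes "\<And>z. poly G z = 0 \<Longrightarrow> norm z = \<rho>"
  shows "norm (poly G 0) = norm (lead_coeff G) * \<rho> ^ degree G"
proof -
  obtain root where root: "smult (lead_coeff G) (\<Prod>i<degree G. [:- root i, 1:]) = G"
    by (rule complex_poly_decompose')
  have eval: "poly G z = lead_coeff G * (\<Prod>i<degree G. z - root i)" for z
    by (subst root [symmetric]) (simp add: poly_prod)
  have "norm (root i) = \<rho>" if "i < degree G" for i
    by (rule assms) (use that in \<open>auto simp: eval\<close>)
  then show ?thesis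
    by (simp add: eval norm_mult prod_norm [symmetric])
qed

lemma map_poly_of_rat_mult:
  "map_poly (of_rat :: rat \<Rightarrow> 'a :: field_char_0) (p * q) = map_poly of_rat p * map_poly of_rat q"
  by (rule poly_eqI) (simp add: coeff_map_poly coeff_mult of_rat_sum of_rat_mult)

lemma map_poly_of_rat_add:
  "map_poly (of_rat :: rat \<Rightarrow> 'a :: field_char_0) (p + q) = map_poly of_rat p + map_poly of_rat q"
  by (rule poly_eqI) (simp add: coeff_map_poly of_rat_add)

lemma map_poly_of_rat_Poly:
  "map_poly (of_rat :: rat \<Rightarrow> 'a :: field_char_0) (Poly cs) = Poly (map of_rat cs)"
  by (induction cs) (simp_all add: map_poly_pCons)

lemma degree_map_poly_of_rat [simp]:
  "degree (map_poly (of_rat :: rat \<Rightarrow> 'a :: field_char_0) p) = degree p"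
  by (rule degree_map_poly) auto

lemma poly_binomial_of_rat:
  "poly (map_poly of_rat (monom 1 q - [:of_nat m:])) (z :: 'a :: field_char_0) = z ^ q - of_nat m"
proof -
  have "map_poly of_rat (monom 1 q - [:of_nat m:]) = (monom 1 q - [:of_nat m:] :: 'a poly)"
    by (rule poly_eqI) (simp add: coeff_map_poly of_rat_diff coeff_pCons split: nat.splits)
  then show ?thesis
    by (simp add: poly_monom)
qed

text \<open>
  All complex roots of a factor of \<open>X\<^sup>q - m\<close> have the same modulus, so up to the leading
  coefficient its constant term is a power of \<open>\<bar>x\<bar>\<close>.
\<close>

lemma rational_power_of_root:
  fixes P :: "rat poly" and x :: real
  assumes "q > 0" "x ^ q = of_nat m" "P \<noteq> 0" "poly (map_poly of_rat P) x = 0"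
  obtains e where "1 \<le> e" "e \<le> degree P" "\<bar>x\<bar> ^ e \<in> \<rat>"
proof -
  define M :: "rat poly" where "M = monom 1 q - [:of_nat m:]"
  \<comment> \<open>By Bezout the gcd still vanishes at \<open>x\<close>, so it is not constant; as
    a divisor of \<open>M\<close> it has only roots of modulus \<open>\<bar>x\<bar>\<close>. Its
    degree is the required exponent.\<close>
  define g where "g = gcd P M"
  have g0: "g \<noteq> 0" using assms(3) by (simp add: g_def)
  obtain u v where uv: "u * P + v * M = g"
    using bezout_coefficients_fst_snd[of P M] unfolding g_def by blast
  have "poly (map_poly of_rat g) x = 0"
    by (simp add: uv [symmetric] map_poly_of_rat_add map_poly_of_rat_mult assms poly_binomial_of_rat M_def
        del: of_rat_diff)
  moreover have "degree g \<noteq> 0 \<or> poly (map_poly of_rat g) x \<noteq> 0"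
    using g0 by (metis degree_eq_zeroE map_poly_pCons map_poly_0 of_rat_eq_0_iff poly_const_conv pCons_0_0)
  ultimately have 1: "1 \<le> degree g" by auto
  have 2: "degree g \<le> degree P"
    using assms(3) by (intro dvd_imp_degree_le) (auto simp: g_def)
  define G :: "complex poly" where "G = map_poly of_rat g"
  have "norm z = \<bar>x\<bar>" if "poly G z = 0" for z
  proof -
    obtain h where "M = g * h" unfolding g_def by (meson dvdE gcd_dvd2)
    then have "poly (map_poly of_rat M) z = 0"
      using that by (simp add: map_poly_of_rat_mult G_def)
    then have "z ^ q = of_nat m" by (simp add: M_def poly_binomial_of_rat)
    then have "norm z ^ q = \<bar>x\<bar> ^ q"
      by (metis assms(2) norm_of_nat norm_power power_abs real_norm_def)
    then show ?thesis using assms(1) by (simp add: power_eq_iff_eq_base)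
  qed
  then have "norm (poly G 0) = norm (lead_coeff G) * \<bar>x\<bar> ^ degree G"
    by (rule norm_poly_0_eq_of_norm_roots_eq)
  moreover have "norm (of_rat a :: complex) = \<bar>of_rat a\<bar>" for a
    by (cases a) (simp add: of_rat_rat norm_divide)
  ultimately have "\<bar>of_rat (coeff g 0)\<bar> = \<bar>of_rat (lead_coeff g)\<bar> * \<bar>x\<bar> ^ degree g"
    by (simp add: G_def poly_0_coeff_0 coeff_map_poly)
  then have "\<bar>x\<bar> ^ degree g = \<bar>of_rat (coeff g 0)\<bar> / \<bar>of_rat (lead_coeff g)\<bar>"
    using g0 by (simp add: field_simps)
  then have "\<bar>x\<bar> ^ degree g \<in> \<rat>" by simp
  then show thesis using that 1 2 by blast
qed

text \<open>With \<open>\<bar>y\<bar> = a / b\<close> in lowest terms, \<open>b ^ p\<close> divides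
  \<open>a ^ p\<close>, so \<open>b\<close> divides \<open>a\<close> and coprimality forces
  \<open>b = 1\<close>.\<close>

lemma nat_power_if_rational_root:
  fixes y :: real
  assumes "y \<in> \<rat>" "y ^ p = of_nat m" "p > 0"
  shows "\<exists>c::nat. m = c ^ p"
proof -
  obtain a b :: nat where ab: "b \<noteq> 0" "\<bar>y\<bar> = of_nat a / of_nat b" "coprime a b"
    using Rats_abs_nat_div_natE[OF assms(1)] by metis
  have "real a ^ p = real m * real b ^ p"
    using assms(2) ab(1,2) by (metis abs_of_nat nonzero_eq_divide_eq of_nat_eq_0_iff power_abs power_divide power_not_zero)
  then have eq: "a ^ p = m * b ^ p"
    by (metis of_nat_eq_iff of_nat_mult of_nat_power)
  then have "b ^ p dvd a ^ p" by simp
  then have "b dvd a" using assms(3) by simp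
  then have "b = 1" using ab(3) by (metis coprime_absorb_right nat_dvd_1_iff_1)
  then show ?thesis using eq by auto
qed

text \<open>By Bezout, the exponents that make a power of \<open>\<bar>x\<bar>\<close> rational are
  closed under gcd, so \<open>\<bar>x\<bar> ^ (p ^ t)\<close> is rational for
  \<open>p ^ t = gcd e (p ^ r)\<close>. If \<open>t < r\<close>, a further power of it would be a
  rational \<open>p\<close>-th root of \<open>m\<close>.\<close>

lemma prime_power_le_of_rational_power:
  fixes x :: real
  assumes p: "prime p" and x: "x ^ (p ^ r) = of_nat m" and m: "\<nexists>c. m = c ^ p" and "m > 0"
    and e: "1 \<le> e" "\<bar>x\<bar> ^ e \<in> \<rat>"
  shows "p ^ r \<le> e"
proof -
  let ?y = "\<bar>x\<bar>"
  have y: "?y ^ (p ^ r) = of_nat m" by (metis abs_of_nat power_abs x)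
  have y0: "?y > 0"
    using y \<open>m > 0\<close> p by (metis abs_ge_zero linorder_not_less nat_less_le of_nat_0_less_iff order_antisym_conv power_0_left prime_gt_0_nat zero_less_power)
  obtain t where t: "t \<le> r" "gcd e (p ^ r) = p ^ t"
    using p by (metis divides_primepow_nat gcd_dvd2)
  obtain u v where uv: "e * u = p ^ r * v + gcd e (p ^ r)"
    using bezout_nat[of e "p ^ r"] e(1) by auto
  have "?y ^ (p ^ t) = (?y ^ e) ^ u / (?y ^ (p ^ r)) ^ v"
    using uv t(2) y0 by (simp add: power_mult [symmetric] power_add)
  also have "\<dots> \<in> \<rat>" using e(2) y by simp
  finally have rat: "?y ^ (p ^ t) \<in> \<rat>" .
  have "t = r"
  proof (rule ccontr)
    assume "t \<noteq> r"
    then have "p ^ r = p ^ t * p ^ (r - t - 1) * p"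
      using t(1) by (simp flip: power_add power_Suc2)
    then have "((?y ^ (p ^ t)) ^ (p ^ (r - t - 1))) ^ p = of_nat m"
      using y by (simp add: power_mult [symmetric])
    then show False
      using nat_power_if_rational_root[of "(?y ^ (p ^ t)) ^ (p ^ (r - t - 1))" p m] rat m prime_gt_0_nat[OF p] by auto
  qed
  then show ?thesis using t(2) e(1) by (metis gcd_le1_nat not_one_le_zero)
qed

section \<open>The field of real numbers and degrees of its elements over the rationals\<close>

abbreviation "RR \<equiv> (ring_of_type_algebra :: real ring)"

lemma field_RR: "field RR"
  by (rule field_from_type_algebra)

interpretation RR: domain RR
  using field_RR by (rule field.axioms)

lemma RR_simps:
  "carrier RR = UNIV" "x \<otimes>\<^bsub>RR\<^esub> y = x * y" "x \<oplus>\<^bsub>RR\<^esub> y = x + y" "\<one>\<^bsub>RR\<^esub> = 1" "\<zero>\<^bsub>RR\<^esub> = 0"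
  by (simp_all add: ring_of_type_algebra_def)

lemma RR_minus: "\<ominus>\<^bsub>RR\<^esub> x = - x"
  by (metis RR.minus_equality RR_simps(1,3,5) UNIV_I add.left_inverse)

lemma RR_inv: "x \<noteq> 0 \<Longrightarrow> inv\<^bsub>RR\<^esub> x = inverse x"
  by (metis RR.comm_inv_char RR_simps(1,2,4) UNIV_I right_inverse)

lemma RR_pow: "x [^]\<^bsub>RR\<^esub> (n::nat) = x ^ n"
  by (induction n) (simp_all add: RR_simps)

lemma subfield_Rats: "subfield \<rat> RR"
proof (rule field.subfieldI'[OF field_RR])
  show "subring \<rat> RR"
    by (rule RR.subringI) (auto simp: RR_simps RR_minus)
  show "inv\<^bsub>RR\<^esub> k \<in> \<rat>" if "k \<in> \<rat> - {\<zero>\<^bsub>RR\<^esub>}" for k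
    using that by (auto simp: RR_simps RR_inv)
qed

lemma Rats_subset_subfield:
  assumes "subfield K RR"
  shows "\<rat> \<subseteq> K"
proof -
  have one: "1 \<in> K" and zero: "0 \<in> K"
    using subringE(2,3)[OF subfieldE(1)[OF assms]] by (simp_all add: RR_simps)
  have add: "a + b \<in> K" if "a \<in> K" "b \<in> K" for a b
    using subringE(7)[OF subfieldE(1)[OF assms] that] by (simp add: RR_simps)
  have mult: "a * b \<in> K" if "a \<in> K" "b \<in> K" for a b
    using subringE(6)[OF subfieldE(1)[OF assms] that] by (simp add: RR_simps)
  have minus: "- a \<in> K" if "a \<in> K" for a
    using subringE(5)[OF subfieldE(1)[OF assms] that] by (simp add: RR_minus)
  have inv: "inverse a \<in> K" if "a \<in> K" for a
    using RR.subfield_m_inv(1)[OF assms, of a] that zero by (cases "a = 0") (auto simp: RR_simps RR_inv)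
  have nat: "of_nat n \<in> K" for n
    by (induction n) (auto intro: one zero add)
  have int: "of_int i \<in> K" for i
    by (cases i rule: int_cases2) (auto intro: nat minus)
  show ?thesis
  proof
    fix c :: real assume "c \<in> \<rat>"
    then obtain a b where "c = of_int a / of_int b" by (rule Rats_cases')
    then show "c \<in> K" by (auto simp: divide_inverse intro: mult inv int)
  qed
qed

text \<open>The field generated by \<open>x\<close> alone already contains the rationals. In the
  form of a simple extension its dimension can be read off from the minimal polynomial.\<close>

lemma generate_field_eq_simple_extension:
  assumes "(RR.algebraic over \<rat>) x"
  shows "generate_field RR {x} = RR.simple_extension \<rat> x"
proof
  have "subfield (RR.simple_extension \<rat> x) RR"
    using RR.simple_extension_is_subfield[OF subfield_Rats] assms by (simp add: RR_simps)
  then show "generate_field RR {x} \<subseteq> RR.simple_extension \<rat> x"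
    using RR.simple_extension_mem[OF subfieldE(1)[OF subfield_Rats], of x]
    by (intro field.generate_field_min_subfield1[OF field_RR]) (auto simp: RR_simps)
next
  have sub: "subfield (generate_field RR {x}) RR"
    by (rule field.generate_field_is_subfield[OF field_RR]) (simp add: RR_simps)
  show "RR.simple_extension \<rat> x \<subseteq> generate_field RR {x}"
    by (rule RR.simple_extension_subring_incl)
      (use sub Rats_subset_subfield[OF sub] in \<open>auto intro: subfieldE(1) generate_field.incl\<close>)
qed

lemma rat_degree_eq_degree_Irr:
  assumes "(RR.algebraic over \<rat>) x"
  shows "rat_degree x = length (RR.Irr \<rat> x) - 1"
  unfolding rat_degree_def generate_field_eq_simple_extension[OF assms]
  using RR.simple_extension_dim[OF subfield_Rats _ assms] by (simp add: RR_simps over_def)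

text \<open>Coefficient lists in HOL-Algebra start with the leading coefficient, those of
  \<open>Poly\<close> with the constant one.\<close>

lemma RR_eval: "RR.eval ps x = poly (Poly (rev ps)) x"
  by (induction ps) (simp_all add: RR_simps RR_pow Poly_append poly_monom)

text \<open>The binomial \<open>X ^ (p ^ r) - m\<close> bounds the degree from above. From below,
  the minimal polynomial yields a rational power \<open>\<bar>x\<bar> ^ e\<close> with
  \<open>e\<close> at most its degree, and every such \<open>e\<close> is at least
  \<open>p ^ r\<close>.\<close>

lemma rat_degree_prime_power_root:
  fixes x :: real
  assumes p: "prime p" and x: "x ^ (p ^ r) = of_nat m" and m: "\<nexists>c. m = c ^ p" and "m > 0"
  shows "rat_degree x = p ^ r"
proof -
  have q: "p ^ r > 0" using p by (simp add: prime_gt_0_nat)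
  \<comment> \<open>This is \<open>X ^ (p ^ r) - m\<close>, leading coefficient first; it also
    witnesses that \<open>x\<close> is algebraic.\<close>
  define B :: "real list" where "B = 1 # replicate (p ^ r - 1) 0 @ [- of_nat m]"
  have B: "B \<in> carrier (\<rat>[X]\<^bsub>RR\<^esub>)" "B \<noteq> []"
    by (auto simp: B_def univ_poly_def polynomial_def RR_simps)
  have "RR.eval B x = x * x ^ (p ^ r - 1) - of_nat m"
    unfolding B_def RR_eval by (simp add: Poly_append poly_monom)
  also have "\<dots> = 0" using x q by (metis diff_self power_eq_if not_less0)
  finally have B0: "RR.eval B x = \<zero>\<^bsub>RR\<^esub>" by (simp add: RR_simps)
  have alg: "(RR.algebraic over \<rat>) x"
    by (rule RR.algebraicI[OF B B0])
  note Irr = RR.IrrE[OF subfield_Rats _ alg]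
  let ?I = "RR.Irr \<rat> x"
  have "?I pdivides\<^bsub>RR\<^esub> B"
    by (rule RR.Irr_minimal[OF subfield_Rats _ alg B(1) B0]) (simp add: RR_simps)
  then have le: "length ?I - 1 \<le> p ^ r"
    using RR.pdivides_imp_degree_le[OF subfieldE(1)[OF subfield_Rats] Irr(1) B] q
    by (simp add: RR_simps B_def)
  have I: "?I \<noteq> []" "set ?I \<subseteq> \<rat>" "RR.eval ?I x = 0" "hd ?I \<noteq> 0"
    using Irr subfieldE(1)[OF subfield_Rats]
    by (auto simp: RR_simps univ_poly_def polynomial_def ring_irreducible_def)
  \<comment> \<open>The minimal polynomial has rational coefficients but real type; a right inverse
    of \<open>of_rat\<close> carries it to \<open>rat poly\<close>.\<close>
  define P :: "rat poly" where "P = Poly (rev (map (inv_into UNIV of_rat) ?I))"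
  have "map of_rat (map (inv_into UNIV of_rat) ?I) = ?I"
    unfolding map_map using I(2) by (intro map_idI) (auto simp: f_inv_into_f Rats_def)
  then have P: "map_poly of_rat P = Poly (rev ?I)"
    by (simp add: P_def map_poly_of_rat_Poly rev_map [symmetric] del: map_map)
  have "degree (Poly (rev ?I)) \<le> length ?I - 1"
    by (metis coeffs_Poly degree_eq_length_coeffs diff_le_mono length_rev length_strip_while_le)
  then have degP: "degree P \<le> length ?I - 1"
    by (simp flip: P)
  have "hd ?I \<in> set (rev ?I)" using I(1) by simp
  then have "Poly (rev ?I) \<noteq> 0"
    using I(4) unfolding Poly_eq_0 by (metis in_set_replicate)
  then have "P \<noteq> 0"
    using P by auto
  moreover have "poly (map_poly of_rat P) x = 0"
    using I(3) by (simp add: P RR_eval)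
  ultimately obtain e where "1 \<le> e" "e \<le> degree P" "\<bar>x\<bar> ^ e \<in> \<rat>"
    using rational_power_of_root[OF q x] by blast
  then have "p ^ r \<le> degree P"
    using prime_power_le_of_rational_power[OF p x m \<open>m > 0\<close>] by fastforce
  then show ?thesis
    using le degP rat_degree_eq_degree_Irr[OF alg] by simp
qed

section \<open>Translations of independent sets\<close>

lemma (in group_action) orbit_finite_card:
  assumes "finite E" "x \<in> E" "Coset.order G = p ^ a" "prime (p::nat)"
  obtains c where "card (orbit G \<phi> x) = p ^ c" "finite (orbit G \<phi> x)"
proof -
  have "orbit G \<phi> x \<subseteq> E"
    using assms(2) element_image by (auto simp: orbit_def)
  then have "finite (orbit G \<phi> x)" using assms(1) finite_subset by blast
  moreover have "card (orbit G \<phi> x) dvd p ^ a"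
    using orbit_stabilizer_theorem[OF assms(2)] assms(3) by (metis dvd_triv_left)
  ultimately show thesis
    using that divides_primepow_nat[OF assms(4)] by blast
qed

text \<open>Orbit lengths are powers of \<open>p\<close>, so every orbit with at least
  \<open>p ^ b\<close> elements contributes a multiple of \<open>p ^ b\<close>.\<close>

lemma (in group_action) card_cong_card_small_orbits:
  assumes fin: "finite E" and "Coset.order G = p ^ a" "prime (p::nat)"
  shows "[card E = card {x \<in> E. card (orbit G \<phi> x) < p ^ b}] (mod p ^ b)"
proof -
  \<comment> \<open>The indicator of the points in large orbits; it is constant on each
    orbit.\<close>
  define f :: "_ \<Rightarrow> nat" where "f x = (if card (orbit G \<phi> x) < p ^ b then 0 else 1)" for x
  have "p ^ b dvd sum f R" if R: "R \<in> orbits G E \<phi>" for R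
  proof -
    obtain x where x: "x \<in> E" "R = orbit G \<phi> x" using R by (auto simp: orbits_def)
    have orb_R: "orbit G \<phi> y = R" if "y \<in> R" for y
    proof -
      have "y \<in> E" using that x element_image by (auto simp: orbit_def)
      then have "orbit G \<phi> y \<in> orbits G E \<phi>" "y \<in> orbit G \<phi> y"
        by (auto simp: orbits_def intro: orbit_refl)
      then show ?thesis using disjoint_union[of "orbit G \<phi> y" R] that R by blast
    qed
    then have sum: "sum f R = (\<Sum>y\<in>R. if card R < p ^ b then 0 else 1)"
      by (intro sum.cong) (auto simp: f_def orb_R)
    obtain c where c: "card R = p ^ c"
      using orbit_finite_card[OF fin x(1) assms(2,3)] x(2) by blast
    show ?thesis
    proof (cases "card R < p ^ b")
      case False
      then have "b \<le> c" using c assms(3) by (metis linorder_not_le power_strict_increasing prime_gt_1_nat)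
      then show ?thesis using sum False c by (simp add: le_imp_power_dvd)
    qed (use sum in simp)
  qed
  then have "p ^ b dvd (\<Sum>R\<in>orbits G E \<phi>. sum f R)" by (rule dvd_sum)
  then have "p ^ b dvd sum f E" using disjoint_sum[OF fin, of f] by simp
  moreover have "sum f E + card {x \<in> E. card (orbit G \<phi> x) < p ^ b} = card E"
  proof -
    have "card {x \<in> E. card (orbit G \<phi> x) < p ^ b} = (\<Sum>x\<in>E. if card (orbit G \<phi> x) < p ^ b then 1 else 0)"
      using fin by (simp add: sum.If_cases Int_def)
    then have "sum f E + card {x \<in> E. card (orbit G \<phi> x) < p ^ b} = (\<Sum>x\<in>E. 1)"
      unfolding f_def by (simp only: sum.distrib [symmetric]) (intro sum.cong, auto)
    then show ?thesis by simp
  qed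
  ultimately show ?thesis
    by (metis cong_add_rcancel_0_nat cong_0_iff)
qed

section \<open>Independent sets and their translates in an abelian \<open>p\<close>-group\<close>

locale independent_translates = comm_group G for G (structure) +
  fixes e :: "nat \<Rightarrow> 'a" and d p a :: nat
  assumes e_closed: "i < d \<Longrightarrow> e i \<in> carrier G"
    and d_pos: "d \<ge> 1" and p: "prime p" and order_G: "Coset.order G = p ^ a"
begin

text \<open>One direction per generator is enough: an edge along an inverse generator is the same
  edge seen from its other end.\<close>

definition indep :: "'a set set" where
  "indep = {I. I \<subseteq> carrier G \<and> (\<forall>x\<in>I. \<forall>i<d. x \<otimes> e i \<notin> I)}"

text \<open>The restriction to \<open>indep\<close> is there because the elements of
  \<open>BijGroup\<close> are extensional functions.\<close>

definition translate :: "'a \<Rightarrow> 'a set \<Rightarrow> 'a set" where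
  "translate g = (\<lambda>I\<in>indep. g <# I)"

lemma finite_carrier: "finite (carrier G)"
  using order_G prime_gt_0_nat[OF p] by (intro card_ge_0_finite) (simp add: Coset.order_def)

lemma finite_indep: "finite indep"
  by (rule finite_subset[of _ "Pow (carrier G)"]) (auto simp: indep_def finite_carrier)

lemma indep_subset: "I \<in> indep \<Longrightarrow> I \<subseteq> carrier G"
  by (simp add: indep_def)

text \<open>Translations multiply on the left and generators on the right, so adjacency is
  preserved.\<close>

lemma l_coset_indep:
  assumes "g \<in> carrier G" "I \<in> indep"
  shows "g <# I \<in> indep"
proof -
  have I: "I \<subseteq> carrier G" "\<And>x i. x \<in> I \<Longrightarrow> i < d \<Longrightarrow> x \<otimes> e i \<notin> I"
    using assms by (auto simp: indep_def)
  have "g \<otimes> x \<otimes> e i \<noteq> g \<otimes> y" if "x \<in> I" "y \<in> I" "i < d" for x y i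
  proof
    assume "g \<otimes> x \<otimes> e i = g \<otimes> y"
    then have "g \<otimes> (x \<otimes> e i) = g \<otimes> y"
      using that I(1) assms(1) e_closed by (simp add: m_assoc subsetD)
    then have "x \<otimes> e i = y"
      using that I(1) assms(1) e_closed by (simp add: subsetD)
    then show False using that I(2) by blast
  qed
  moreover have "g <# I \<subseteq> carrier G"
    using I(1) assms(1) by (rule l_coset_subset_G)
  ultimately show ?thesis
    unfolding indep_def l_coset_def by blast
qed

lemma translation_action: "group_action G indep translate"
proof -
  have bij: "translate g \<in> Bij indep" if "g \<in> carrier G" for g
  proof -
    have "bij_betw (\<lambda>I. g <# I) indep indep"
    proof (rule bij_betw_byWitness[where f' = "\<lambda>I. inv g <# I"])
      show "\<forall>I\<in>indep. inv g <# (g <# I) = I" "\<forall>I\<in>indep. g <# (inv g <# I) = I"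
        using that by (auto simp: lcos_m_assoc indep_subset lcos_mult_one)
    qed (use that l_coset_indep in auto)
    then show ?thesis
      by (simp add: Bij_def translate_def)
  qed
  show ?thesis
  proof (rule group_action.intro, intro group_hom.intro group_hom_axioms.intro homI is_group group_BijGroup)
    show "translate g \<in> carrier (BijGroup indep)" if "g \<in> carrier G" for g
      using bij[OF that] by (simp add: BijGroup_def)
    show "translate (g \<otimes> h) = translate g \<otimes>\<^bsub>BijGroup indep\<^esub> translate h"
      if "g \<in> carrier G" "h \<in> carrier G" for g h
    proof -
      have "translate (g \<otimes> h) I = compose indep (translate g) (translate h) I" for I
        using that by (cases "I \<in> indep")
          (simp_all add: translate_def compose_def lcos_m_assoc indep_subset l_coset_indep)
      then show ?thesis
        using that bij by (simp add: BijGroup_def fun_eq_iff)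
    qed
  qed
qed

sublocale act: group_action G indep translate
  by (rule translation_action)

abbreviation orb :: "'a set \<Rightarrow> 'a set set" where
  "orb \<equiv> orbit G translate"

lemma orbit_eq: "I \<in> indep \<Longrightarrow> orb I = {g <# I |g. g \<in> carrier G}"
  by (simp add: orbit_def translate_def)

lemma empty_indep: "{} \<in> indep"
  by (simp add: indep_def)

lemma orbit_empty: "orb {} = {{}}"
  using one_closed by (auto simp: orbit_eq[OF empty_indep] l_coset_def)

text \<open>Together with a point \<open>x\<close>, the set would contain its neighbour
  \<open>x \<otimes> e i\<close>.\<close>

lemma fixed_by_generator_empty:
  assumes "I \<in> indep" "i < d" "e i <# I = I"
  shows "I = {}"
proof (rule ccontr)
  assume "I \<noteq> {}"
  then obtain x where x: "x \<in> I" by blast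
  then have "e i \<otimes> x \<in> I" using assms(3) by (auto simp: l_coset_def)
  then have "x \<otimes> e i \<in> I" using x assms e_closed indep_subset by (metis m_comm subsetD)
  then show False using x assms by (auto simp: indep_def)
qed

text \<open>An orbit with fewer than \<open>p\<close> elements has length 1, and a set fixed by
  \<open>e 0\<close> is empty.\<close>

lemma card_indep_cong_1: "[card indep = 1] (mod p)"
proof -
  have "{I \<in> indep. card (orb I) < p ^ 1} = {{}}"
  proof (intro Set.set_eqI iffI)
    fix I assume "I \<in> {I \<in> indep. card (orb I) < p ^ 1}"
    then have I: "I \<in> indep" "card (orb I) < p ^ 1" by auto
    obtain c where c: "card (orb I) = p ^ c" "finite (orb I)"
      using act.orbit_finite_card[OF finite_indep I(1) order_G p] .
    then have "c < 1" using I(2) by (metis p power_less_imp_less_exp prime_gt_1_nat)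
    then have "card (orb I) = 1" using c by simp
    moreover have "I \<in> orb I" "e 0 <# I \<in> orb I"
      using act.orbit_refl I(1) e_closed[of 0] d_pos by (auto simp: orbit_eq)
    ultimately have "e 0 <# I = I" by (metis card_1_singletonE singletonD)
    then show "I \<in> {{}}" using fixed_by_generator_empty[OF I(1), of 0] d_pos by simp
  next
    fix I :: "'a set" assume "I \<in> {{}}"
    then show "I \<in> {I \<in> indep. card (orb I) < p ^ 1}"
      using prime_gt_1_nat[OF p] empty_indep orbit_empty by simp
  qed
  then show ?thesis
    using act.card_cong_card_small_orbits[OF finite_indep order_G p, of 1] by simp
qed

section \<open>Orbits with fewer than \<open>p ^ 2\<close> elements\<close>

lemma l_coset_inject:
  assumes "g \<in> carrier G" "I \<subseteq> carrier G" "J \<subseteq> carrier G" "g <# I = g <# J"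
  shows "I = J"
proof -
  have "inv g <# (g <# K) = K" if "K \<subseteq> carrier G" for K
    using that assms(1) by (simp add: lcos_m_assoc lcos_mult_one)
  then show ?thesis using assms(2-4) by metis
qed

text \<open>
  The orbit has exactly \<open>p\<close> elements, and \<open>e 0\<close> moves \<open>I\<close>, so the \<open>p\<close> translates of \<open>I\<close> by powers
  of \<open>e 0\<close> exhaust it.
\<close>

lemma small_orbit_generators:
  assumes I: "I \<in> indep" "I \<noteq> {}" and small: "card (orb I) < p ^ 2"
  obtains \<epsilon> where "\<epsilon> 0 = 1" "\<And>i. i < d \<Longrightarrow> \<epsilon> i \<in> {1..<p}"
    "\<And>i. i < d \<Longrightarrow> e i <# I = e 0 [^] \<epsilon> i <# I" "e 0 [^] p <# I = I"
proof -
  have e0: "e 0 \<in> carrier G" using e_closed d_pos by simp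
  have IG: "I \<subseteq> carrier G" using I indep_subset by blast
  have p1: "p > 1" using p by (rule prime_gt_1_nat)
  define T where "T j = e 0 [^] j <# I" for j :: nat
  have T0: "T 0 = I" by (simp add: T_def lcos_mult_one IG)
  have T_add: "T (i + j) = e 0 [^] i <# T j" for i j
    using e0 IG by (simp add: T_def lcos_m_assoc nat_pow_mult)
  have T_sub: "T j \<subseteq> carrier G" for j
    using e0 IG by (simp add: T_def l_coset_subset_G)
  have T_ord: "T (p ^ a) = I"
    using e0 pow_order_eq_1[OF e0] by (simp add: T_def order_G lcos_mult_one IG)
  \<comment> \<open>The period of \<open>I\<close> under \<open>e 0\<close>. It divides the group
    order, so it is a power of \<open>p\<close>, and the first \<open>t\<close> translates are
    distinct.\<close>
  define t where "t = (LEAST j. j > 0 \<and> T j = I)"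
  have t: "t > 0" "T t = I" and t_least: "\<And>j. j > 0 \<Longrightarrow> T j = I \<Longrightarrow> t \<le> j"
    using LeastI[of "\<lambda>j. j > 0 \<and> T j = I" "p ^ a"] T_ord p1
    by (auto simp: t_def intro: Least_le)
  have T_mult: "T (t * q) = I" for q
  proof (induction q)
    case (Suc q)
    then have "T (t * Suc q) = e 0 [^] t <# T (t * q)" by (metis T_add mult_Suc_right)
    then show ?case using Suc t(2) T_add[of t 0] T0 by simp
  qed (simp add: T0)
  have T_mod: "T (j mod t) = T j" for j
  proof -
    have "T j = e 0 [^] (j mod t) <# T (t * (j div t))"
      by (metis T_add mod_mult_div_eq)
    then show ?thesis by (simp only: T_mult) (simp add: T_def)
  qed
  have "t dvd p ^ a"
  proof (rule ccontr)
    assume "\<not> t dvd p ^ a"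
    then have "p ^ a mod t > 0" by (simp add: mod_greater_zero_iff_not_dvd)
    moreover have "T (p ^ a mod t) = I" using T_mod T_ord by simp
    ultimately show False using t_least t(1) by (metis mod_less_divisor not_le)
  qed
  then obtain c where c: "t = p ^ c" using divides_primepow_nat[OF p] by blast
  have inj: "inj_on T {..<t}"
  proof (rule linorder_inj_onI)
    fix i j assume ij: "i < j" "i \<in> {..<t}" "j \<in> {..<t}"
    show "T i \<noteq> T j"
    proof
      assume "T i = T j"
      then have "e 0 [^] i <# T 0 = e 0 [^] i <# T (j - i)"
        using T_add[of i 0] T_add[of i "j - i"] ij by simp
      then have "T (j - i) = I"
        using l_coset_inject[of "e 0 [^] i" "T 0" "T (j - i)"] e0 IG T_sub T0 by simp
      then show False using t_least[of "j - i"] ij by simp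
    qed
  qed auto
  have T_orb: "T j \<in> orb I" for j
    using e0 I(1) by (auto simp: orbit_eq T_def)
  obtain b where b: "card (orb I) = p ^ b" "finite (orb I)"
    using act.orbit_finite_card[OF finite_indep I(1) order_G p] .
  have "T 1 \<noteq> I"
    using fixed_by_generator_empty[OF I(1), of 0] I(2) d_pos e0 by (auto simp: T_def)
  then have "t \<noteq> 1" using t(2) by metis
  then have c1: "c \<ge> 1" using c by (cases c) auto
  have card_T: "card (T ` {..<t}) = t"
    using inj by (simp add: card_image)
  \<comment> \<open>These \<open>p ^ c\<close> distinct translates lie in an orbit of
    \<open>p ^ b < p ^ 2\<close> elements, and \<open>c \<ge> 1\<close> since \<open>e 0\<close>
    moves \<open>I\<close>; hence both exponents are 1.\<close>
  have sub: "T ` {..<t} \<subseteq> orb I" using T_orb by blast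
  then have "p ^ c \<le> p ^ b" using card_mono[OF b(2) sub] card_T c b(1) by simp
  then have "c \<le> b" using p1 power_le_imp_le_exp by blast
  moreover have "b < 2" using small b(1) p1 by (metis power_less_imp_less_exp)
  ultimately have "b = 1" "c = 1" using c1 by auto
  then have tp: "t = p" using c by simp
  then have orb: "T ` {..<p} = orb I"
    using card_subset_eq[OF b(2) sub] card_T b(1) \<open>b = 1\<close> by simp
  have "\<exists>j\<in>{1..<p}. e i <# I = T j" if "i < d" for i
  proof -
    have "e i <# I \<in> orb I" using e_closed[OF that] I(1) by (auto simp: orbit_eq)
    then obtain j where j: "j < p" "e i <# I = T j" using orb by blast
    moreover have "j \<noteq> 0" using j T0 fixed_by_generator_empty[OF I(1) that] I(2) by metis
    ultimately show ?thesis by (intro bexI[of _ j]) auto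
  qed
  then have "\<forall>i\<in>{..<d}. \<exists>j. j \<in> {1..<p} \<and> e i <# I = T j" by blast
  then obtain \<delta> where \<delta>: "\<forall>i\<in>{..<d}. \<delta> i \<in> {1..<p} \<and> e i <# I = T (\<delta> i)"
    using bchoice by (metis (no_types))
  show thesis
  \<comment> \<open>Setting the value at 0 to 1 is legitimate, since the first power of
    \<open>e 0\<close> is \<open>e 0\<close> itself.\<close>
  proof (rule that[of "\<delta>(0 := 1)"])
    fix i assume "i < d"
    then have i: "\<delta> i \<in> {1..<p}" "e i <# I = T (\<delta> i)" using \<delta> by auto
    show "(\<delta>(0 := 1)) i \<in> {1..<p}" using i p1 by simp
    show "e i <# I = e 0 [^] (\<delta>(0 := 1)) i <# I"
      using i(2) e0 by (cases "i = 0") (simp_all add: T_def)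
  next
    show "e 0 [^] p <# I = I" using t(2) tp by (simp add: T_def)
  qed simp
qed

text \<open>By commutativity, translating both sides by \<open>inv x \<otimes> inv y\<close> gives
  \<open>inv y <# I = inv x <# I\<close>. Membership of \<open>z\<close> in \<open>I\<close> amounts
  to that of \<open>\<one>\<close> in \<open>inv z <# I\<close>.\<close>

lemma mem_iff_of_same_translate:
  assumes "I \<subseteq> carrier G" "x \<in> carrier G" "y \<in> carrier G" "x <# I = y <# I"
  shows "x \<in> I \<longleftrightarrow> y \<in> I"
proof -
  have mem: "z \<in> I \<longleftrightarrow> \<one> \<in> inv z <# I" if z: "z \<in> carrier G" for z
  proof
    assume "z \<in> I"
    then show "\<one> \<in> inv z <# I"
      using z unfolding l_coset_def by (intro UN_I[of z]) simp_all
  next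
    assume "\<one> \<in> inv z <# I"
    then obtain u where u: "u \<in> I" "\<one> = inv z \<otimes> u" by (auto simp: l_coset_def)
    have "z \<otimes> (inv z \<otimes> u) = u"
      using z u(1) assms(1) by (simp add: m_assoc [symmetric] subsetD)
    then have "u = z" using z by (simp flip: u(2))
    then show "z \<in> I" using u by simp
  qed
  have "inv x \<otimes> inv y \<otimes> y = inv x"
    using assms(2,3) by (simp add: m_assoc)
  moreover have "inv x \<otimes> inv y \<otimes> x = inv y"
    using assms(2,3) by (simp add: m_comm[of "inv x"] m_assoc)
  moreover have "inv x \<otimes> inv y <# (x <# I) = inv x \<otimes> inv y <# (y <# I)"
    using assms(4) by simp
  ultimately have "inv x <# I = inv y <# I"
    using assms(1-3) by (simp add: lcos_m_assoc)
  then show ?thesis using mem assms(2,3) by simp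
qed

end

lemma cayley_independent:
  assumes "I \<subseteq> carrier G"
  shows "(\<forall>E\<in>snd (cayley_graph G S). \<not> E \<subseteq> I) \<longleftrightarrow> (\<forall>x\<in>I. \<forall>s\<in>S. x \<otimes>\<^bsub>G\<^esub> s \<notin> I)"
proof -
  have "(\<forall>E\<in>snd (cayley_graph G S). \<not> E \<subseteq> I) \<longleftrightarrow>
      (\<forall>x\<in>carrier G. \<forall>s\<in>S. \<not> {x, x \<otimes>\<^bsub>G\<^esub> s} \<subseteq> I)"
    unfolding cayley_graph_def snd_conv by blast
  then show ?thesis using assms by auto
qed

section \<open>Counting modulo the square of the prime\<close>

lemma carrier_torus: "n > 0 \<Longrightarrow> carrier (torus_group d n) = (\<Pi>\<^sub>E i\<in>{..<d}. {0..<int n})"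
  by (simp add: torus_group_def carrier_integer_mod_group)

lemma mult_torus: "x \<otimes>\<^bsub>torus_group d n\<^esub> y = (\<lambda>i\<in>{..<d}. (x i + y i) mod int n)"
  by (simp add: torus_group_def)

lemma one_torus: "\<one>\<^bsub>torus_group d n\<^esub> = (\<lambda>i\<in>{..<d}. 0)"
  by (simp add: torus_group_def)

lemma comm_group_torus: "comm_group (torus_group d n)"
proof (rule group.group_comm_groupI)
  show "group (torus_group d n)" by (simp add: torus_group_def)
qed (simp add: mult_torus add.commute)

lemma order_torus: "n > 0 \<Longrightarrow> Coset.order (torus_group d n) = n ^ d"
  by (simp add: Coset.order_def carrier_torus card_PiE)

lemma basis_vec_closed: "n > 0 \<Longrightarrow> basis_vec d n i \<in> carrier (torus_group d n)"
  by (auto simp: carrier_torus basis_vec_def)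

locale prime_power_torus =
  fixes d p k :: nat
  assumes d_ge_1: "d \<ge> 1" and prime_p: "prime p" and k_ge_1: "k \<ge> 1"
begin

abbreviation "n \<equiv> p ^ k"
abbreviation "T \<equiv> torus_group d n"

lemma n_ge_p: "p \<le> n"
  using k_ge_1 prime_gt_0_nat[OF prime_p] by (metis power_increasing power_one_right Suc_leI One_nat_def)

lemma n_gt_1: "n > 1"
  using n_ge_p prime_gt_1_nat[OF prime_p] by linarith

lemma n_pos: "n > 0"
  using n_gt_1 by linarith

lemma p_dvd_n: "int p dvd int n"
  using k_ge_1 by (simp add: dvd_power)

end

sublocale prime_power_torus \<subseteq> independent_translates "torus_group d (p ^ k)" "basis_vec d (p ^ k)" d p "k * d"
proof (intro independent_translates.intro independent_translates_axioms.intro comm_group_torus)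
  show "Coset.order T = p ^ (k * d)" using n_pos by (simp add: order_torus power_mult)
qed (use d_ge_1 prime_p n_pos basis_vec_closed in auto)

context prime_power_torus
begin

abbreviation e :: "nat \<Rightarrow> nat \<Rightarrow> int" where "e \<equiv> basis_vec d n"

lemma carrier_T: "carrier T = (\<Pi>\<^sub>E i\<in>{..<d}. {0..<int n})"
  using n_pos by (rule carrier_torus)

lemma one_mod_n [simp]: "1 mod int p ^ k = 1"
  using n_gt_1 by (metis mod_pos_pos_trivial of_nat_1 of_nat_less_iff of_nat_power zero_le_one)

lemma basis_vec_apply: "j < d \<Longrightarrow> e i j = (if j = i then 1 else 0)"
  by (simp add: basis_vec_def)

text \<open>As \<open>n > 1\<close>, no generator is trivial, so removing the identity changes
  nothing. An inverse generator adds no condition: \<open>x\<close> is the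
  \<open>e i\<close>-neighbour of \<open>x\<close> times the inverse of \<open>e i\<close>.\<close>

lemma independent_sets_torus: "independent_sets (torus_graph d n) = indep"
proof -
  have e_ne: "e i \<noteq> \<one>\<^bsub>T\<^esub>" if i: "i < d" for i
  proof
    assume "e i = \<one>\<^bsub>T\<^esub>"
    then have "e i i = (\<one>\<^bsub>T\<^esub>) i" by (rule arg_cong)
    then show False using i by (simp add: basis_vec_apply one_torus)
  qed
  have e_inv: "inv\<^bsub>T\<^esub> (e i) \<noteq> \<one>\<^bsub>T\<^esub>" if i: "i < d" for i
    using e_ne[OF i] inv_eq_1_iff[OF e_closed[OF i]] by simp
  have "(\<Union>i<d. {e i, inv\<^bsub>T\<^esub> (e i)}) \<inter> {\<one>\<^bsub>T\<^esub>} = {}"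
  proof (rule equals0I)
    fix s assume "s \<in> (\<Union>i<d. {e i, inv\<^bsub>T\<^esub> (e i)}) \<inter> {\<one>\<^bsub>T\<^esub>}"
    then obtain i where "i < d" "s = e i \<or> s = inv\<^bsub>T\<^esub> (e i)" "s = \<one>\<^bsub>T\<^esub>" by blast
    then show False using e_ne[of i] e_inv[of i] by argo
  qed
  then have gens: "torus_gens d n = (\<Union>i<d. {e i, inv\<^bsub>T\<^esub> (e i)})"
    unfolding torus_gens_def by (rule Diff_triv)
  have "(\<forall>x\<in>I. \<forall>s\<in>torus_gens d n. x \<otimes>\<^bsub>T\<^esub> s \<notin> I) \<longleftrightarrow> (\<forall>x\<in>I. \<forall>i<d. x \<otimes>\<^bsub>T\<^esub> e i \<notin> I)" (is "?l \<longleftrightarrow> ?r")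
    if I: "I \<subseteq> carrier T" for I
  proof
    assume ?l then show ?r unfolding gens by blast
  next
    assume r: ?r
    have "x \<otimes>\<^bsub>T\<^esub> inv\<^bsub>T\<^esub> (e i) \<notin> I" if x: "x \<in> I" and i: "i < d" for x i
    proof
      assume "x \<otimes>\<^bsub>T\<^esub> inv\<^bsub>T\<^esub> (e i) \<in> I"
      then have "x \<otimes>\<^bsub>T\<^esub> inv\<^bsub>T\<^esub> (e i) \<otimes>\<^bsub>T\<^esub> e i \<notin> I" using r i by simp
      moreover have "x \<otimes>\<^bsub>T\<^esub> inv\<^bsub>T\<^esub> (e i) \<otimes>\<^bsub>T\<^esub> e i = x"
        using subsetD[OF I x] e_closed[OF i] by (simp add: m_assoc)
      ultimately show False using x by simp
    qed
    then show ?l using r unfolding gens by blast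
  qed
  then show ?thesis
    unfolding independent_sets_def indep_def torus_graph_def
    by (intro Collect_cong conj_cong) (simp_all add: cayley_independent, simp add: cayley_graph_def)
qed

section \<open>Fibres of linear functionals modulo \<open>p\<close>\<close>

definition weight :: "(nat \<Rightarrow> nat) \<Rightarrow> (nat \<Rightarrow> int) \<Rightarrow> int" where
  "weight \<epsilon> x = (\<Sum>i<d. int (\<epsilon> i) * x i)"

definition level :: "(nat \<Rightarrow> nat) \<Rightarrow> nat \<Rightarrow> (nat \<Rightarrow> int) set" where
  "level \<epsilon> b = {x \<in> carrier T. weight \<epsilon> x mod int p = int b}"

text \<open>A functional that vanishes modulo \<open>p\<close> on a basis vector has no nonempty
  independent fibre. Proportional functionals share their fibres, and the value 1 at index 0 selects
  one of them.\<close>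

definition slopes :: "(nat \<Rightarrow> nat) set" where
  "slopes = (\<Pi>\<^sub>E i\<in>{..<d}. if i = 0 then {1} else {1..<p})"

lemma slopesD: "\<epsilon> \<in> slopes \<Longrightarrow> i < d \<Longrightarrow> 1 \<le> \<epsilon> i \<and> \<epsilon> i < p"
  using prime_gt_1_nat[OF prime_p] by (auto simp: slopes_def PiE_iff split: if_splits)

lemma slopes_0: "\<epsilon> \<in> slopes \<Longrightarrow> \<epsilon> 0 = 1"
  using d_ge_1 by (auto simp: slopes_def dest!: PiE_mem[of _ _ _ 0])

text \<open>Coordinates are reduced modulo \<open>n\<close>, which \<open>p\<close> divides, so
  residues modulo \<open>p\<close> survive the reduction.\<close>

lemma weight_mult: "weight \<epsilon> (x \<otimes>\<^bsub>T\<^esub> y) mod int p = (weight \<epsilon> x + weight \<epsilon> y) mod int p"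
proof -
  have "[int (\<epsilon> i) * ((x i + y i) mod int n) = int (\<epsilon> i) * (x i + y i)] (mod int p)" for i
    using p_dvd_n by (intro cong_scalar_left) (simp only: cong_def mod_mod_cancel)
  then have "[(\<Sum>i<d. int (\<epsilon> i) * ((x i + y i) mod int n)) = (\<Sum>i<d. int (\<epsilon> i) * (x i + y i))] (mod int p)"
    by (intro cong_sum)
  then show ?thesis
    by (simp add: weight_def mult_torus cong_def distrib_left sum.distrib)
qed

lemma weight_basis: "i < d \<Longrightarrow> weight \<epsilon> (e i) = int (\<epsilon> i)"
proof -
  assume i: "i < d"
  have "weight \<epsilon> (e i) = (\<Sum>j<d. if j = i then int (\<epsilon> i) else 0)"
    unfolding weight_def by (intro sum.cong) (auto simp: basis_vec_apply)
  then show ?thesis using i by simp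
qed

lemma weight_nonneg: "x \<in> carrier T \<Longrightarrow> weight \<epsilon> x \<ge> 0"
  by (auto simp: weight_def carrier_T PiE_iff intro!: sum_nonneg)

text \<open>One step along axis \<open>i\<close> acts on \<open>I\<close> like
  \<open>\<epsilon> i\<close> steps along axis 0. The induction on the coordinate sum peels one
  basis vector off a positive coordinate.\<close>

lemma translate_eq_power:
  assumes I: "I \<subseteq> carrier T"
    and gen: "\<And>i. i < d \<Longrightarrow> e i <#\<^bsub>T\<^esub> I = e 0 [^]\<^bsub>T\<^esub> \<epsilon> i <#\<^bsub>T\<^esub> I"
    and x: "x \<in> carrier T"
  shows "x <#\<^bsub>T\<^esub> I = e 0 [^]\<^bsub>T\<^esub> nat (weight \<epsilon> x) <#\<^bsub>T\<^esub> I"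
  using x
proof (induction "nat (\<Sum>i<d. x i)" arbitrary: x rule: less_induct)
  case less
  have e0: "e 0 \<in> carrier T" using e_closed d_ge_1 by simp
  have x: "\<And>i. i < d \<Longrightarrow> 0 \<le> x i \<and> x i < int n" "\<And>i. i \<ge> d \<Longrightarrow> x i = undefined"
    using less.prems by (auto simp: carrier_T PiE_iff extensional_def)
  show ?case
  proof (cases "\<exists>i<d. x i > 0")
    case False
    then have "\<And>i. i < d \<Longrightarrow> x i = 0" using x by force
    then have "x = \<one>\<^bsub>T\<^esub>" "weight \<epsilon> x = 0"
      using x(2) by (auto simp: one_torus weight_def)
    then show ?thesis by simp
  next
    case True
    then obtain i where i: "i < d" "x i > 0" by blast
    define y where "y = x(i := x i - 1)"
    have y: "y \<in> carrier T"
      using i x by (auto simp: y_def carrier_T PiE_iff extensional_def intro: less_trans[of _ "x i"])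
    have xy: "x = y \<otimes>\<^bsub>T\<^esub> e i"
    proof
      fix j show "x j = (y \<otimes>\<^bsub>T\<^esub> e i) j"
        using x(1)[of j] x(2)[of j] by (cases "j < d"; cases "j = i") (simp_all add: mult_torus y_def basis_vec_apply)
    qed
    have upd: "(\<Sum>j<d. c j * x j) = (\<Sum>j<d. c j * y j) + c i" for c :: "nat \<Rightarrow> int"
    proof -
      have "(\<Sum>j<d. c j * x j) = (\<Sum>j<d. c j * y j + (if j = i then c i else 0))"
        by (intro sum.cong) (auto simp: y_def algebra_simps)
      then show ?thesis using i by (simp add: sum.distrib)
    qed
    have "(\<Sum>j<d. x j) = (\<Sum>j<d. y j) + 1"
      using upd[of "\<lambda>_. 1"] by simp
    moreover have "(\<Sum>j<d. y j) \<ge> 0"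
      using y by (auto simp: carrier_T PiE_iff intro!: sum_nonneg)
    ultimately have IH: "y <#\<^bsub>T\<^esub> I = e 0 [^]\<^bsub>T\<^esub> nat (weight \<epsilon> y) <#\<^bsub>T\<^esub> I"
      using less.hyps[of y] y by simp
    have "weight \<epsilon> x = weight \<epsilon> y + int (\<epsilon> i)"
      using upd[of "\<lambda>j. int (\<epsilon> j)"] by (simp add: weight_def)
    then have w: "nat (weight \<epsilon> x) = \<epsilon> i + nat (weight \<epsilon> y)"
      using weight_nonneg[OF y] by (simp add: nat_add_distrib)
    have "x <#\<^bsub>T\<^esub> I = y <#\<^bsub>T\<^esub> (e i <#\<^bsub>T\<^esub> I)"
      using y e_closed[OF i(1)] I by (simp add: xy lcos_m_assoc)
    also have "\<dots> = (y \<otimes>\<^bsub>T\<^esub> e 0 [^]\<^bsub>T\<^esub> \<epsilon> i) <#\<^bsub>T\<^esub> I"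
      using y e0 I by (simp add: gen[OF i(1)] lcos_m_assoc)
    also have "\<dots> = e 0 [^]\<^bsub>T\<^esub> \<epsilon> i <#\<^bsub>T\<^esub> (y <#\<^bsub>T\<^esub> I)"
      using y e0 I by (simp add: m_comm[of y] lcos_m_assoc)
    also have "\<dots> = e 0 [^]\<^bsub>T\<^esub> nat (weight \<epsilon> x) <#\<^bsub>T\<^esub> I"
      using e0 I by (simp add: IH w lcos_m_assoc nat_pow_mult)
    finally show ?thesis .
  qed
qed

end

text \<open>This is where \<open>p \<le> 3\<close> matters: any two distinct residues modulo 2 or 3
  are cyclic neighbours, so \<open>step\<close> leaves room for only one.\<close>

lemma exactly_one_residue:
  fixes R :: "nat \<Rightarrow> bool"
  assumes p: "p = 2 \<or> p = 3" and mod: "\<And>j. R (j mod p) \<longleftrightarrow> R j"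
    and step: "\<And>j. R j \<Longrightarrow> \<not> R (Suc j)" and ex: "R j"
  obtains b where "b < p" "\<And>i. R i \<longleftrightarrow> i mod p = b"
proof -
  have uniq: "c = c'" if "R c" "R c'" "c < p" "c' < p" for c c'
  proof (rule ccontr)
    assume ne: "c \<noteq> c'"
    from p have "Suc c mod p = c' \<or> Suc c' mod p = c"
    proof
      assume "p = 2"
      then show ?thesis using ne that(3,4) by presburger
    next
      assume "p = 3"
      then show ?thesis using ne that(3,4) by presburger
    qed
    then have "R (Suc c) \<or> R (Suc c')"
      using mod[of "Suc c"] mod[of "Suc c'"] that(1,2) by metis
    then show False using step that(1,2) by blast
  qed
  have p0: "p > 0" using p by auto
  show thesis
  proof (rule that[of "j mod p"])
    show "j mod p < p" using p0 by simp
    fix i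
    have less: "i mod p < p" "j mod p < p" using p0 by simp_all
    show "R i \<longleftrightarrow> i mod p = j mod p"
    proof
      assume "R i"
      then show "i mod p = j mod p"
        using uniq[OF _ _ less] mod[of i] mod[of j] ex by blast
    next
      assume "i mod p = j mod p"
      then show "R i" using mod[of i] mod[of j] ex by metis
    qed
  qed
qed

context prime_power_torus
begin

text \<open>Membership of \<open>x\<close> depends only on \<open>weight \<epsilon> x\<close>, which
  reduces the claim to the trace of \<open>I\<close> on the powers of \<open>e 0\<close>. That trace
  has period \<open>p\<close> and no two consecutive exponents.\<close>

lemma small_orbit_is_level:
  assumes p23: "p = 2 \<or> p = 3"
    and I: "I \<in> indep" "I \<noteq> {}" and small: "card (orb I) < p ^ 2"
  shows "\<exists>\<epsilon>\<in>slopes. \<exists>b<p. I = level \<epsilon> b"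
proof -
  obtain \<delta> where \<delta>: "\<delta> 0 = 1" "\<And>i. i < d \<Longrightarrow> \<delta> i \<in> {1..<p}"
    "\<And>i. i < d \<Longrightarrow> e i <#\<^bsub>T\<^esub> I = e 0 [^]\<^bsub>T\<^esub> \<delta> i <#\<^bsub>T\<^esub> I"
    and period: "e 0 [^]\<^bsub>T\<^esub> p <#\<^bsub>T\<^esub> I = I"
    using small_orbit_generators[OF I small] by blast
  \<comment> \<open>The restriction makes the function extensional, as \<open>slopes\<close>
    demands.\<close>
  define \<epsilon> where "\<epsilon> = restrict \<delta> {..<d}"
  have \<epsilon>: "\<epsilon> \<in> slopes"
    using \<delta>(1,2) by (auto simp: slopes_def \<epsilon>_def)
  have IT: "I \<subseteq> carrier T" using I(1) by (rule indep_subset)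
  have e0: "e 0 \<in> carrier T" using e_closed d_ge_1 by simp
  have translate: "x <#\<^bsub>T\<^esub> I = e 0 [^]\<^bsub>T\<^esub> nat (weight \<epsilon> x) <#\<^bsub>T\<^esub> I" if "x \<in> carrier T" for x
    using IT _ that by (rule translate_eq_power) (use \<delta>(3) in \<open>simp add: \<epsilon>_def\<close>)
  define R where "R j \<longleftrightarrow> e 0 [^]\<^bsub>T\<^esub> j \<in> I" for j :: nat
  have mem: "x \<in> I \<longleftrightarrow> R (nat (weight \<epsilon> x))" if "x \<in> carrier T" for x
    unfolding R_def using IT that _ translate[OF that]
    by (rule mem_iff_of_same_translate) (use e0 in simp)
  have period_mult: "e 0 [^]\<^bsub>T\<^esub> (p * q) <#\<^bsub>T\<^esub> I = I" for q
  proof (induction q)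
    case (Suc q)
    have "e 0 [^]\<^bsub>T\<^esub> (p * Suc q) <#\<^bsub>T\<^esub> I = e 0 [^]\<^bsub>T\<^esub> p <#\<^bsub>T\<^esub> (e 0 [^]\<^bsub>T\<^esub> (p * q) <#\<^bsub>T\<^esub> I)"
      using e0 IT by (simp add: lcos_m_assoc nat_pow_mult)
    then show ?case by (simp add: Suc period)
  qed (simp add: lcos_mult_one IT)
  have R_mod: "R (j mod p) \<longleftrightarrow> R j" for j
  proof -
    have "e 0 [^]\<^bsub>T\<^esub> (j mod p) <#\<^bsub>T\<^esub> (e 0 [^]\<^bsub>T\<^esub> (p * (j div p)) <#\<^bsub>T\<^esub> I)
        = e 0 [^]\<^bsub>T\<^esub> (j mod p + p * (j div p)) <#\<^bsub>T\<^esub> I"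
      using e0 IT by (simp only: lcos_m_assoc nat_pow_mult nat_pow_closed)
    then have "e 0 [^]\<^bsub>T\<^esub> (j mod p) <#\<^bsub>T\<^esub> I = e 0 [^]\<^bsub>T\<^esub> j <#\<^bsub>T\<^esub> I"
      by (simp add: period_mult)
    then show ?thesis
      unfolding R_def using e0 by (intro mem_iff_of_same_translate[OF IT]) simp_all
  qed
  have step: "\<not> R (Suc j)" if "R j" for j
    using that I(1) d_ge_1 by (simp add: R_def indep_def)
  obtain x where "x \<in> I" using I(2) by blast
  then have "R (nat (weight \<epsilon> x))" using mem IT by blast
  then obtain b where b: "b < p" "\<And>i. R i \<longleftrightarrow> i mod p = b"
    using exactly_one_residue[OF p23 R_mod step] by blast
  have "I = level \<epsilon> b"
  proof (rule Set.set_eqI)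
    fix x
    have "int (nat (weight \<epsilon> x) mod p) = weight \<epsilon> x mod int p" if "x \<in> carrier T"
      using weight_nonneg[OF that, of \<epsilon>] by (simp add: zmod_int)
    then have "x \<in> carrier T \<Longrightarrow> nat (weight \<epsilon> x) mod p = b \<longleftrightarrow> weight \<epsilon> x mod int p = int b"
      by linarith
    then show "x \<in> I \<longleftrightarrow> x \<in> level \<epsilon> b"
      using mem[of x] b(2) IT unfolding level_def by blast
  qed
  then show ?thesis using \<epsilon> b(1) by blast
qed

text \<open>A step along \<open>e i\<close> changes the weight by \<open>\<epsilon> i\<close>, which
  is not divisible by \<open>p\<close>.\<close>

lemma level_indep:
  assumes "\<epsilon> \<in> slopes"
  shows "level \<epsilon> b \<in> indep"
proof -
  have "x \<otimes>\<^bsub>T\<^esub> e i \<notin> level \<epsilon> b" if x: "x \<in> level \<epsilon> b" and i: "i < d" for x i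
  proof
    assume "x \<otimes>\<^bsub>T\<^esub> e i \<in> level \<epsilon> b"
    then have "(weight \<epsilon> x + int (\<epsilon> i)) mod int p = weight \<epsilon> x mod int p"
      using x by (simp add: level_def weight_mult weight_basis[OF i])
    then have "int p dvd int (\<epsilon> i)"
      by (simp add: mod_eq_dvd_iff)
    then show False
      using slopesD[OF assms i] by (auto dest: dvd_imp_le)
  qed
  then show ?thesis by (auto simp: indep_def) (simp add: level_def)
qed

lemma translate_level:
  assumes g: "g \<in> carrier T" and b: "b < p"
  shows "g <#\<^bsub>T\<^esub> level \<epsilon> b = level \<epsilon> (nat ((weight \<epsilon> g + int b) mod int p))" (is "_ = level \<epsilon> ?c")
proof -
  have p0: "int p > 0" using prime_gt_0_nat[OF prime_p] by simp
  then have c: "int ?c = (weight \<epsilon> g + int b) mod int p" by simp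
  have iff: "g \<otimes>\<^bsub>T\<^esub> z \<in> level \<epsilon> ?c \<longleftrightarrow> z \<in> level \<epsilon> b" if z: "z \<in> carrier T" for z
  proof -
    have "(weight \<epsilon> g + weight \<epsilon> z) mod int p = (weight \<epsilon> g + int b) mod int p
        \<longleftrightarrow> weight \<epsilon> z mod int p = int b mod int p"
      by (simp add: mod_eq_dvd_iff)
    then show ?thesis
      using g z b by (simp add: level_def weight_mult c del: int_nat_eq)
  qed
  have level_sub: "level \<epsilon> c \<subseteq> carrier T" for c by (auto simp: level_def)
  show ?thesis
  proof
    show "g <#\<^bsub>T\<^esub> level \<epsilon> b \<subseteq> level \<epsilon> ?c"
      using iff level_sub unfolding l_coset_def by blast
    show "level \<epsilon> ?c \<subseteq> g <#\<^bsub>T\<^esub> level \<epsilon> b"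
    proof
      fix y assume y: "y \<in> level \<epsilon> ?c"
      then have yT: "y \<in> carrier T" using level_sub by blast
      define z where "z = inv\<^bsub>T\<^esub> g \<otimes>\<^bsub>T\<^esub> y"
      have z: "z \<in> carrier T" "y = g \<otimes>\<^bsub>T\<^esub> z"
        using g yT by (simp_all add: z_def m_assoc [symmetric])
      then show "y \<in> g <#\<^bsub>T\<^esub> level \<epsilon> b"
        using iff[OF z(1)] y unfolding l_coset_def by blast
    qed
  qed
qed

text \<open>Translations permute the fibres of one functional, and there are only \<open>p\<close>
  of them.\<close>

lemma level_small_orbit:
  assumes \<epsilon>: "\<epsilon> \<in> slopes" and b: "b < p"
  shows "card (orb (level \<epsilon> b)) < p ^ 2"
proof -
  have p1: "p > 1" using prime_p by (rule prime_gt_1_nat)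
  have "orb (level \<epsilon> b) \<subseteq> level \<epsilon> ` {..<p}"
  proof
    fix J assume "J \<in> orb (level \<epsilon> b)"
    then obtain g where g: "g \<in> carrier T" "J = g <#\<^bsub>T\<^esub> level \<epsilon> b"
      unfolding orbit_eq[OF level_indep[OF \<epsilon>]] by blast
    have "nat ((weight \<epsilon> g + int b) mod int p) < p"
      using p1 by (simp add: nat_less_iff)
    then show "J \<in> level \<epsilon> ` {..<p}"
      unfolding g(2) translate_level[OF g(1) b] by blast
  qed
  then have "card (orb (level \<epsilon> b)) \<le> card {..<p}"
    by (rule surj_card_le[rotated]) simp
  also have "\<dots> < p ^ 2" using p1 by (simp add: power2_eq_square)
  finally show ?thesis .
qed

text \<open>Test points for telling levels apart: as \<open>\<epsilon> 0 = 1\<close>, the coordinate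
  \<open>c\<close> moves the weight to any residue, and the entry 1 at \<open>i > 0\<close> makes it
  sensitive to \<open>\<epsilon> i\<close>.\<close>

definition corner :: "nat \<Rightarrow> int \<Rightarrow> nat \<Rightarrow> int" where
  "corner i c = (\<lambda>j\<in>{..<d}. if j = 0 then c else if j = i then 1 else 0)"

lemma corner_closed: "0 \<le> c \<Longrightarrow> c < int p \<Longrightarrow> corner i c \<in> carrier T"
  using n_ge_p n_gt_1 by (auto simp: corner_def carrier_T simp flip: of_nat_power)

lemma weight_corner:
  assumes "\<epsilon> \<in> slopes"
  shows "weight \<epsilon> (corner i c) = c + (if 0 < i \<and> i < d then int (\<epsilon> i) else 0)"
proof -
  have "weight \<epsilon> (corner i c) =
      (\<Sum>j<d. (if j = 0 then c else 0) + (if j = i then if 0 < i then int (\<epsilon> i) else 0 else 0))"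
    unfolding weight_def using slopes_0[OF assms] by (intro sum.cong) (auto simp: corner_def)
  then show ?thesis using d_ge_1 by (simp add: sum.distrib)
qed

lemma level_nonempty:
  assumes "\<epsilon> \<in> slopes" "b < p"
  shows "corner 0 (int b) \<in> level \<epsilon> b"
  using assms by (simp add: level_def corner_closed weight_corner)

text \<open>The point \<open>corner 0 b\<close> recovers \<open>b\<close>. Then
  \<open>corner i c\<close>, with \<open>c\<close> chosen to give weight \<open>b\<close> modulo
  \<open>p\<close> under \<open>\<epsilon>\<close>, recovers \<open>\<epsilon> i\<close>.\<close>

lemma level_inject:
  assumes \<epsilon>: "\<epsilon> \<in> slopes" "b < p" and \<epsilon>': "\<epsilon>' \<in> slopes" "b' < p" and eq: "level \<epsilon> b = level \<epsilon>' b'"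
  shows "\<epsilon> = \<epsilon>' \<and> b = b'"
proof
  have "corner 0 (int b) \<in> level \<epsilon>' b'" using level_nonempty[OF \<epsilon>] eq by simp
  then show b: "b = b'" using \<epsilon>(2) by (simp add: level_def weight_corner[OF \<epsilon>'(1)])
  have "\<epsilon> i = \<epsilon>' i" if i: "i < d" for i
  proof (cases "i = 0")
    case False
    define c where "c = (int b - int (\<epsilon> i)) mod int p"
    have p0: "int p > 0" using prime_gt_0_nat[OF prime_p] by simp
    have c: "0 \<le> c" "c < int p" using p0 by (simp_all add: c_def)
    have "(c + int (\<epsilon> i)) mod int p = int b"
      using \<epsilon>(2) by (simp add: c_def mod_simps)
    then have "corner i c \<in> level \<epsilon> b"
      using i False by (simp add: level_def corner_closed[OF c] weight_corner[OF \<epsilon>(1)])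
    then have "corner i c \<in> level \<epsilon>' b" using eq b by simp
    then have "(c + int (\<epsilon>' i)) mod int p = int b"
      using i False by (simp add: level_def weight_corner[OF \<epsilon>'(1)])
    then have "int p dvd (c + int (\<epsilon> i)) - (c + int (\<epsilon>' i))"
      using \<open>(c + int (\<epsilon> i)) mod int p = int b\<close> by (metis mod_eq_dvd_iff)
    then have "int (\<epsilon> i) mod int p = int (\<epsilon>' i) mod int p"
      by (simp add: mod_eq_dvd_iff)
    then show ?thesis
      using slopesD[OF \<epsilon>(1) i] slopesD[OF \<epsilon>'(1) i] by simp
  qed (simp add: slopes_0[OF \<epsilon>(1)] slopes_0[OF \<epsilon>'(1)])
  then show "\<epsilon> = \<epsilon>'"
    using \<epsilon>(1) \<epsilon>'(1) unfolding slopes_def by (intro PiE_ext[of \<epsilon> _ _ \<epsilon>']) auto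
qed

lemma card_slopes: "card slopes = (p - 1) ^ (d - 1)"
proof -
  have "{..<d} = insert 0 {1..<d}" using d_ge_1 by auto
  moreover have "(\<Prod>i\<in>{1..<d}. card (if i = 0 then {1} else {1..<p})) = (\<Prod>i\<in>{1..<d}. p - 1)"
    by (intro prod.cong) auto
  ultimately show ?thesis
    by (simp add: slopes_def card_PiE)
qed

text \<open>Only the empty set and the levels have orbits shorter than \<open>p ^ 2\<close>, and
  distinct pairs of a slope and a residue give distinct levels.\<close>

lemma card_indep_cong_square:
  assumes "p = 2 \<or> p = 3"
  shows "[card indep = 1 + p * (p - 1) ^ (d - 1)] (mod p ^ 2)"
proof -
  let ?L = "(\<lambda>(\<epsilon>, b). level \<epsilon> b) ` (slopes \<times> {..<p})"
  have "{I \<in> indep. card (orb I) < p ^ 2} = insert {} ?L"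
  proof (rule equalityI; rule subsetI)
    fix I assume "I \<in> {I \<in> indep. card (orb I) < p ^ 2}"
    then show "I \<in> insert {} ?L" using small_orbit_is_level[OF assms] by blast
  next
    fix I assume "I \<in> insert {} ?L"
    then consider "I = {}" | \<epsilon> b where "\<epsilon> \<in> slopes" "b < p" "I = level \<epsilon> b" by blast
    then show "I \<in> {I \<in> indep. card (orb I) < p ^ 2}"
    proof cases
      case 1
      then show ?thesis
        using empty_indep orbit_empty one_less_power[OF prime_gt_1_nat[OF prime_p], of 2] by simp
    next
      case 2
      then show ?thesis using level_indep level_small_orbit by blast
    qed
  qed
  moreover have "{} \<notin> ?L" using level_nonempty by blast
  moreover have "inj_on (\<lambda>(\<epsilon>, b). level \<epsilon> b) (slopes \<times> {..<p})"
    using level_inject by (auto simp: inj_on_def)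
  then have "card ?L = p * (p - 1) ^ (d - 1)"
    by (simp add: card_image card_cartesian_product card_slopes)
  moreover have "finite ?L"
    by (simp add: slopes_def finite_PiE)
  ultimately have "card {I \<in> indep. card (orb I) < p ^ 2} = 1 + p * (p - 1) ^ (d - 1)"
    by simp
  then show ?thesis
    using act.card_cong_card_small_orbits[OF finite_indep order_G prime_p, of 2] by simp
qed

end

section \<open>Degree of the growth constant\<close>

text \<open>In \<open>m ^ p - 1 = (m - 1) * (\<Sum>i<p. m ^ i)\<close> the second factor consists of
  \<open>p\<close> terms congruent to 1, which supplies the extra factor \<open>p\<close>.\<close>

lemma cong_1_power_prime:
  fixes m :: nat
  assumes "[m = 1] (mod p ^ j)" "j \<ge> 1"
  shows "[m ^ p = 1] (mod p ^ Suc j)"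
proof -
  have "int (p ^ j) dvd int m - 1"
    using assms(1) by (metis cong_iff_dvd_diff cong_int_iff of_nat_1)
  moreover have "int p dvd (\<Sum>i<p. int m ^ i)"
  proof -
    have "[int m = 1] (mod int p)"
      using assms by (metis cong_dvd_modulus cong_int_iff dvd_power of_nat_1 of_nat_dvd_iff less_le_trans zero_less_one)
    then have "[int m ^ i = 1] (mod int p)" for i
      using cong_pow[of "int m" 1 "int p" i] by simp
    then have "[(\<Sum>i<p. int m ^ i) = (\<Sum>i<p. 1)] (mod int p)"
      by (intro cong_sum)
    then show ?thesis by (simp add: cong_dvd_iff)
  qed
  ultimately have "int (p ^ j) * int p dvd (int m - 1) * (\<Sum>i<p. int m ^ i)"
    by (rule mult_dvd_mono)
  also have "(int m - 1) * (\<Sum>i<p. int m ^ i) = int (m ^ p) - 1"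
    using power_diff_1_eq[of "int m" p] by simp
  finally have "int (p ^ Suc j) dvd int (m ^ p) - int 1" by (simp add: mult.commute)
  then show ?thesis by (simp only: cong_iff_dvd_diff flip: cong_int_iff)
qed

lemma cong_1_power_prime_power:
  fixes m :: nat
  assumes "[m = 1] (mod p)"
  shows "[m ^ (p ^ s) = 1] (mod p ^ Suc s)"
proof (induction s)
  case (Suc s)
  then show ?case using cong_1_power_prime[of "m ^ (p ^ s)" p "Suc s"]
    by (simp add: power_mult [symmetric] mult.commute)
qed (use assms in simp)

text \<open>Iterated Fermat; it passes the congruence of the count \<open>m ^ (p ^ s)\<close> on to
  its base \<open>m\<close>.\<close>

lemma power_prime_power_cong_self:
  fixes m :: nat
  assumes "prime p"
  shows "[m ^ (p ^ s) = m] (mod p)"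
proof (induction s)
  case (Suc s)
  have "[(m ^ p ^ s) ^ p = m ^ p ^ s] (mod p)"
  proof (cases "p dvd m ^ p ^ s")
    case True
    moreover from True have "p dvd (m ^ p ^ s) ^ p"
      using prime_gt_0_nat[OF assms] by (simp add: dvd_trans[OF _ dvd_power])
    ultimately show ?thesis by (simp add: cong_def mod_eq_0_iff_dvd)
  next
    case False
    have "[(m ^ p ^ s) ^ (p - 1) = 1] (mod p)"
      using fermat_theorem[OF assms False] .
    then have "[(m ^ p ^ s) ^ (p - 1) * m ^ p ^ s = 1 * m ^ p ^ s] (mod p)"
      by (rule cong_scalar_right)
    then show ?thesis
      using prime_gt_0_nat[OF assms] by (simp only: power_minus_mult mult_1)
  qed
  then show ?case using Suc by (simp add: power_mult [symmetric] mult.commute) (metis cong_trans)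
qed simp

section \<open>Size of the counts and degree of \<open>kappa d\<close>\<close>

context prime_power_torus
begin

lemma indep_count_eq: "indep_count d n = card indep"
  by (simp add: indep_count_def independent_sets_torus)

lemma indep_count_cong_1: "[indep_count d n = 1] (mod p)"
  using card_indep_cong_1 by (simp add: indep_count_eq)

lemma indep_count_le: "indep_count d n \<le> 2 ^ (p ^ (k * d))"
proof -
  have "card indep \<le> card (Pow (carrier T))"
    using finite_carrier indep_subset by (intro card_mono) auto
  also have "\<dots> = 2 ^ (p ^ (k * d))"
    using finite_carrier order_G by (simp add: card_Pow Coset.order_def)
  finally show ?thesis by (simp add: indep_count_eq)
qed

text \<open>The empty set and a singleton are independent. The bound keeps
  \<open>indep_count d n - 1\<close> nonzero, so that divisibility bounds its multiplicity from
  below.\<close>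

lemma indep_count_ge_2: "indep_count d n \<ge> 2"
proof -
  have "{\<one>\<^bsub>T\<^esub>} \<in> indep"
  proof -
    have "\<one>\<^bsub>T\<^esub> \<otimes>\<^bsub>T\<^esub> e i \<noteq> \<one>\<^bsub>T\<^esub>" if i: "i < d" for i
    proof
      assume "\<one>\<^bsub>T\<^esub> \<otimes>\<^bsub>T\<^esub> e i = \<one>\<^bsub>T\<^esub>"
      then have "(\<one>\<^bsub>T\<^esub> \<otimes>\<^bsub>T\<^esub> e i) i = (\<one>\<^bsub>T\<^esub>) i" by (rule arg_cong)
      then show False using i by (simp add: mult_torus one_torus basis_vec_apply)
    qed
    then show ?thesis using one_closed by (simp add: indep_def)
  qed
  then have "card {{}, {\<one>\<^bsub>T\<^esub>}} \<le> card indep"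
    using empty_indep by (intro card_mono finite_indep) simp
  then show ?thesis by (simp add: indep_count_eq)
qed

lemma E_set_degree:
  assumes E: "n \<in> E_set d"
  obtains m r s where "rat_degree (kappa d) = p ^ r" "r \<ge> 1" "r + s = k * d"
    "indep_count d n = m ^ (p ^ s)" "[m = 1] (mod p)" "\<nexists>c. m = c ^ p" "p = 2 \<or> p = 3 \<Longrightarrow> s = 0"
proof -
  have p1: "p > 1" using prime_p by (rule prime_gt_1_nat)
  define A where "A = indep_count d n"
  have A: "[A = 1] (mod p)" "A \<ge> 2" "A \<le> 2 ^ (p ^ (k * d))"
    using indep_count_cong_1 indep_count_ge_2 indep_count_le by (simp_all add: A_def)
  have kap: "kappa d ^ (p ^ (k * d)) = of_nat A"
    using E by (simp add: E_set_def A_def power_mult)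
  \<comment> \<open>Capping \<open>s\<close> at \<open>k * d\<close> ensures that a greatest one
    exists. Once \<open>s < k * d\<close> is known, \<open>Suc s\<close> still respects the cap, so
    maximality keeps \<open>m\<close> from being a \<open>p\<close>-th power.\<close>
  define P where "P s \<longleftrightarrow> s \<le> k * d \<and> (\<exists>m. A = m ^ (p ^ s))" for s
  have "P 0" by (simp add: P_def)
  define s where "s = (GREATEST s. P s)"
  have P_le: "t \<le> k * d" if "P t" for t using that by (simp add: P_def)
  have Ps: "P s"
    unfolding s_def using \<open>P 0\<close> P_le by (rule GreatestI_nat)
  have s_max: "t \<le> s" if "P t" for t
    unfolding s_def using that P_le by (rule Greatest_le_nat)
  obtain m where m: "A = m ^ (p ^ s)" using Ps by (auto simp: P_def)
  have m_cong: "[m = 1] (mod p)"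
    using cong_trans[OF cong_sym[OF power_prime_power_cong_self[OF prime_p, of m s]]] A(1) m by simp
  have "m \<noteq> 0"
  proof
    assume "m = 0"
    then show False using m A(2) p1 by (simp add: power_0_left)
  qed
  moreover have "m \<noteq> 1" using m A(2) by auto
  moreover have "m \<noteq> 2"
  proof
    assume "m = 2"
    then have "p dvd 1" using m_cong cong_altdef_nat[of 1 m p] by (simp add: cong_sym)
    then show False using p1 by simp
  qed
  ultimately have m3: "m \<ge> 3" by simp
  have "s \<noteq> k * d"
  proof
    assume "s = k * d"
    then have "m ^ (p ^ s) \<le> 2 ^ (p ^ s)" using m A(3) by simp
    then have "m \<le> 2" using p1 by (simp add: power_mono_iff)
    then show False using m3 by simp
  qed
  then have s: "s < k * d" using Ps by (simp add: P_def)
  define r where "r = k * d - s"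
  have r: "r \<ge> 1" "r + s = k * d" using s by (simp_all add: r_def)
  have not_pow: "\<nexists>c. m = c ^ p"
  proof
    assume "\<exists>c. m = c ^ p"
    then obtain c where "m = c ^ p" by blast
    then have "A = c ^ (p ^ Suc s)" using m by (simp add: power_mult)
    then have "P (Suc s)" unfolding P_def using s by (intro conjI exI[of _ c]) simp_all
    then show False using s_max[of "Suc s"] by simp
  qed
  have s0: "s = 0" if p23: "p = 2 \<or> p = 3"
  proof (rule ccontr)
    \<comment> \<open>Then \<open>A\<close> is 1 modulo \<open>p ^ 2\<close>, and the count of short
      orbits would make \<open>p\<close> divide a power of \<open>p - 1\<close>.\<close>
    assume "s \<noteq> 0"
    then have "p ^ 2 dvd p ^ Suc s" by (intro le_imp_power_dvd) simp
    with cong_1_power_prime_power[OF m_cong, of s] have 1: "[A = 1] (mod p ^ 2)"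
      unfolding m by (rule cong_dvd_modulus_nat)
    have 2: "[A = 1 + p * (p - 1) ^ (d - 1)] (mod p ^ 2)"
      using card_indep_cong_square[OF p23] by (simp only: A_def indep_count_eq)
    have "[1 + p * (p - 1) ^ (d - 1) = 1 + 0] (mod p ^ 2)"
      using cong_trans[OF cong_sym[OF 2] 1] by simp
    then have "p * p dvd p * (p - 1) ^ (d - 1)"
      by (simp only: cong_add_lcancel_nat cong_0_iff power2_eq_square)
    then have "p dvd (p - 1) ^ (d - 1)" using p1 by simp
    then have "p dvd p - 1" by (rule prime_dvd_power[OF prime_p])
    then show False using p1 by (auto dest: dvd_imp_le)
  qed
  \<comment> \<open>An odd root is unique; for \<open>p = 2\<close>, where only the sign of \<open>kappa d\<close> could be in doubt, \<open>s = 0\<close>.\<close>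
  have "kappa d ^ (p ^ r) = of_nat m"
  proof (cases "p = 2")
    case True
    then show ?thesis using kap s0 m r by simp
  next
    case False
    then have "odd (p ^ s)" using prime_p p1 by (simp add: prime_odd_nat)
    moreover have "(kappa d ^ (p ^ r)) ^ (p ^ s) = of_nat m ^ (p ^ s)"
      using kap m r(2) by (simp flip: power_mult power_add)
    ultimately show ?thesis
      by (metis odd_real_root_power_cancel)
  qed
  then have "rat_degree (kappa d) = p ^ r"
    using rat_degree_prime_power_root[OF prime_p _ not_pow] \<open>m \<noteq> 0\<close> by simp
  then show thesis
    using that r m m_cong not_pow s0 by (simp add: A_def)
qed

end

theorem theorem5p9:
  fixes d p k D :: nat
  assumes "d \<ge> 1"
    and "algebraic (kappa d)"
    and "D = rat_degree (kappa d)"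
    and "prime p"
    and "k \<ge> 1"
    and "p ^ k \<in> E_set d"
  shows "(\<exists>r\<ge>1. D = p ^ r) \<and>
    (p \<in> Tame d \<and> odd p \<longrightarrow>
       (\<exists>r. D = p ^ r \<and> r \<le> k * d \<and>
            int (k * d) \<le> int r + int (multiplicity p (indep_count d p - 1)) - 1) \<and>
       finite {j. j \<ge> 1 \<and> p ^ j \<in> E_set d} \<and>
       int (card {j. j \<ge> 1 \<and> p ^ j \<in> E_set d})
         \<le> \<lfloor>(real (multiplicity p (indep_count d p - 1)) - 1) / real d\<rfloor> + 1) \<and>
    (p = 2 \<or> p = 3 \<longrightarrow>
       D = p ^ (k * d) \<and>
       (\<forall>i j. p ^ i \<in> E_set d \<and> p ^ j \<in> E_set d \<longrightarrow> i = j))"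
proof -
  have p1: "p > 1" using \<open>prime p\<close> by (rule prime_gt_1_nat)
  define v where "v = multiplicity p (indep_count d p - 1)"
  \<comment> \<open>The exponent \<open>r\<close> is determined by \<open>D\<close>, so one value
    serves every \<open>j\<close> with \<open>p ^ j\<close> in \<open>E_set d\<close>; this is what
    makes different powers of \<open>p\<close> comparable.\<close>
  obtain r where r: "D = p ^ r" "r \<ge> 1"
    and bound: "\<And>j. j \<ge> 1 \<Longrightarrow> p ^ j \<in> E_set d \<Longrightarrow> r \<le> j * d \<and> (p \<in> Tame d \<longrightarrow> j * d + 1 \<le> r + v)"
    and not_power: "p = 2 \<or> p = 3 \<Longrightarrow> \<nexists>c. indep_count d (p ^ k) = c ^ p"
    and small: "\<And>j. j \<ge> 1 \<Longrightarrow> p ^ j \<in> E_set d \<Longrightarrow> p = 2 \<or> p = 3 \<Longrightarrow> r = j * d"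
  proof -
    interpret prime_power_torus d p k
      using assms by unfold_locales auto
    obtain m r s where deg: "rat_degree (kappa d) = p ^ r" and r1: "r \<ge> 1" and "r + s = k * d"
      and m: "indep_count d (p ^ k) = m ^ (p ^ s)" and "[m = 1] (mod p)"
      and m': "\<nexists>c. m = c ^ p" "p = 2 \<or> p = 3 \<Longrightarrow> s = 0"
      by (rule E_set_degree[OF assms(6)]) (rule that)
    have r: "D = p ^ r" "r \<ge> 1" using deg r1 assms(3) by simp_all
    have not_power: "\<nexists>c. indep_count d (p ^ k) = c ^ p" if "p = 2 \<or> p = 3"
      using m m' that by simp
    have key: "r \<le> j * d \<and> (p \<in> Tame d \<longrightarrow> j * d + 1 \<le> r + v) \<and> (p = 2 \<or> p = 3 \<longrightarrow> r = j * d)"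
      if j: "j \<ge> 1" "p ^ j \<in> E_set d" for j
    proof -
      interpret j: prime_power_torus d p j
        using assms j by unfold_locales auto
      obtain m r' s where *: "rat_degree (kappa d) = p ^ r'" "r' \<ge> 1" "r' + s = j * d"
        "indep_count d (p ^ j) = m ^ (p ^ s)" "[m = 1] (mod p)" "\<nexists>c. m = c ^ p"
        "p = 2 \<or> p = 3 \<Longrightarrow> s = 0"
        by (rule j.E_set_degree[OF j(2)]) (rule that)
      have "r' = r" using *(1) r(1) assms(3) p1 by simp
      \<comment> \<open>The count at \<open>p ^ j\<close> is 1 modulo \<open>p ^ Suc s\<close>;
        tameness transfers the resulting lower bound on the multiplicity from \<open>p ^ j\<close>
        to \<open>p\<close>.\<close>
      moreover have "s + 1 \<le> v" if "p \<in> Tame d"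
      proof -
        have "[m ^ (p ^ s) = 1] (mod p ^ Suc s)"
          using cong_1_power_prime_power[OF *(5)] .
        then have "p ^ Suc s dvd indep_count d (p ^ j) - 1"
          using *(4) j.indep_count_ge_2 by (simp add: cong_altdef_nat)
        then have "Suc s \<le> multiplicity p (indep_count d (p ^ j) - 1)"
          using j.indep_count_ge_2 p1 by (intro multiplicity_geI) auto
        then show ?thesis using that j(1) by (simp add: Tame_def v_def)
      qed
      ultimately show ?thesis
        using *(3,7) by (intro conjI impI) simp_all
    qed
    show thesis
    proof (rule that[OF r _ not_power])
      fix j assume "j \<ge> 1" "p ^ j \<in> E_set d"
      note j = key[OF this]
      show "r \<le> j * d \<and> (p \<in> Tame d \<longrightarrow> j * d + 1 \<le> r + v)" using j by blast
      show "r = j * d" if "p = 2 \<or> p = 3" using j that by blast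
    qed
  qed
  show ?thesis
  proof (intro conjI impI allI)
    show "\<exists>r\<ge>1. D = p ^ r" using r by blast
  next
    assume "p \<in> Tame d \<and> odd p"
    then have tame: "p \<in> Tame d" by simp
    show "\<exists>r. D = p ^ r \<and> r \<le> k * d \<and>
            int (k * d) \<le> int r + int (multiplicity p (indep_count d p - 1)) - 1"
    proof (intro exI conjI)
      show "D = p ^ r" by (rule r(1))
      show "r \<le> k * d" using bound[OF assms(5,6)] by blast
      have "k * d + 1 \<le> r + v" using bound[OF assms(5,6)] tame by blast
      then show "int (k * d) \<le> int r + int (multiplicity p (indep_count d p - 1)) - 1"
        unfolding v_def by linarith
    qed
    let ?J = "{j. j \<ge> 1 \<and> p ^ j \<in> E_set d}"
    define a where "a = (LEAST j. j \<in> ?J)"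
    have "k \<in> ?J" using assms(5,6) by simp
    then have a: "a \<in> ?J" unfolding a_def by (rule LeastI)
    have a_le: "a \<le> j" if "j \<in> ?J" for j unfolding a_def using that by (rule Least_le)
    \<comment> \<open>For the least member \<open>a\<close> and any member \<open>j\<close>,
      \<open>j * d + 1 \<le> r + v \<le> a * d + v\<close>.\<close>
    have sub: "?J \<subseteq> {a..a + (v - 1) div d}"
    proof
      fix j assume j: "j \<in> ?J"
      have "j * d + 1 \<le> r + v" "r \<le> a * d" using bound[of j] bound[of a] j a tame by simp_all
      then have "(j - a) * d \<le> v - 1"
        by (simp add: diff_mult_distrib)
      then have "j - a \<le> (v - 1) div d"
        using assms(1) by (simp add: less_eq_div_iff_mult_less_eq)
      then show "j \<in> {a..a + (v - 1) div d}" using a_le[OF j] by auto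
    qed
    then show "finite ?J" by (rule finite_subset) simp
    \<comment> \<open>Hence the truncated difference \<open>v - 1\<close> agrees with the real one
      inside the floor.\<close>
    have v1: "v \<ge> 1" using bound[OF assms(5,6)] tame by auto
    have "card ?J \<le> (v - 1) div d + 1"
      using card_mono[OF _ sub] by simp
    moreover have "\<lfloor>(real v - 1) / real d\<rfloor> = int ((v - 1) div d)"
    proof -
      have "real v - 1 = real (v - 1)" using v1 by (simp add: of_nat_diff)
      then show ?thesis by (simp only: floor_divide_of_nat_eq)
    qed
    ultimately show "int (card ?J) \<le> \<lfloor>(real (multiplicity p (indep_count d p - 1)) - 1) / real d\<rfloor> + 1"
      by (simp add: v_def)
  next
    assume p23: "p = 2 \<or> p = 3"
    show "D = p ^ (k * d)" using r(1) small[OF assms(5,6) p23] by simp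
    \<comment> \<open>The exponent 0 is outside the range of \<open>small\<close>. If 1 were in
      \<open>E_set d\<close>, \<open>kappa d\<close> would be a natural number and the count at
      \<open>p ^ k\<close> a \<open>p\<close>-th power.\<close>
    have not_1: "p ^ 0 \<notin> E_set d"
    proof
      assume "p ^ 0 \<in> E_set d"
      then have "kappa d = of_nat (indep_count d 1)" by (simp add: E_set_def)
      moreover have "real (indep_count d (p ^ k)) = kappa d ^ (p ^ (k * d))"
        using assms(6) by (simp add: E_set_def power_mult)
      ultimately have "indep_count d (p ^ k) = indep_count d 1 ^ (p ^ (k * d))"
        by (simp flip: of_nat_power)
      also have "p ^ (k * d) = p ^ (k * d - 1) * p"
        using assms(1,5) by (intro power_minus_mult [symmetric]) simp
      finally have "indep_count d (p ^ k) = (indep_count d 1 ^ (p ^ (k * d - 1))) ^ p"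
        by (simp add: power_mult)
      then show False using not_power p23 by blast
    qed
    fix i j assume ij: "p ^ i \<in> E_set d \<and> p ^ j \<in> E_set d"
    have pos: "l \<ge> 1" if "p ^ l \<in> E_set d" for l
      using that not_1 by (cases l) simp_all
    have "r = i * d" "r = j * d" using ij pos p23 small by blast+
    then have "i * d = j * d" by (rule trans[OF sym])
    then show "i = j" using assms(1) by simp
  qed
qed

end
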